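(* Let $u, v \in F_2$ be nontrivial elements with $\|u\| \ge \|v\|$, let $\Omega$ be the set of all chains of type (C1) or (C2) of length less than or equal to $2\|u\|+5$, let $\Omega_1$ be the subset of $\Omega$ consisting of all chains of type (C1), and let $\Omega_2$ be the subset of $\Omega$ consisting of all chains of type (C2). Put $k=\|u\|+1$. Suppose that $u$ and $v$ are boundedly translation equivalent in $F_2$. Then \[ \|\sigma^{k+1}\psi_1(u)\|=\|\sigma^k\psi_1(u)\| \text{ if and only if } \|\sigma^{k+1}\psi_1(v)\|=\|\sigma^k\psi_1(v)\|, \] \[ \|\tau^{k+1}\psi_1(u)\|=\|\tau^k\psi_1(u)\| \text{ if and only if } \|\tau^{k+1}\psi_1(v)\|=\|\tau^k\psi_1(v)\| \] for every $\psi_1\in\Omega_1$, and \[ \|\sigma^{-k-1}\psi_2(u)\|=\|\sigma^{-k}\psi_2(u)\| \text{ if and only if } \|\sigma^{-k-1}\psi_2(v)\|=\|\sigma^{-k}\psi_2(v)\|, \] \[ \|\tau^{-k-1}\psi_2(u)\|=\|\tau^{-k}\psi_2(u)\| \text{ if and only if } \|\tau^{-k-1}\psi_2(v)\|=\|\tau^{-k}\psi_2(v)\| \] for every $\psi_2\in\Omega_2$.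
   Context: $F_2$ is the free group with basis $\{a,b\}$. For $w\in F_2$, $\|w\|$ denotes the cyclic length of $w$, i.e. the length of a cyclically reduced word conjugate to $w$. Compositions act on the left: $\phi\psi(u)=\phi(\psi(u))$. Let $\sigma,\tau$ be the automorphisms of $F_2$ with $\sigma(a)=ab,\ \sigma(b)=b$ and $\tau(a)=a,\ \tau(b)=ba$. A chain of type (C1) is a composition $\tau^{m_k}\sigma^{l_k}\cdots\tau^{m_1}\sigma^{l_1}$, and a chain of type (C2) is a composition $\tau^{-m_k}\sigma^{-l_k}\cdots\tau^{-m_1}\sigma^{-l_1}$, with $k\in\mathbb{N}$ and all $l_i,m_i\ge 0$; the length of such a chain is $\sum_{i}(m_i+l_i)$. Two nontrivial elements $u,v\in F_2$ are boundedly translation equivalent in $F_2$ if there is $C>0$ such that $\frac1C\le\frac{\|\phi(u)\|}{\|\phi(v)\|}\le C$ for every automorphism $\phi$ of $F_2$. *)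

theory Defs
  imports Complex_Main "HOL-Algebra.Bij"
begin

section \<open>The free group with basis a, b\<close>

text \<open>Elements are freely reduced words; the letter \<open>(g, True)\<close> stands for the generator \<open>g\<close>
  and \<open>(g, False)\<close> for its inverse.\<close>

datatype gen = Gen_a | Gen_b

type_synonym letter = "gen \<times> bool"
type_synonym word = "letter list"

definition inv_letter :: "letter \<Rightarrow> letter" where
  "inv_letter x = (fst x, \<not> snd x)"

definition reduced :: "word \<Rightarrow> bool" where
  "reduced w \<longleftrightarrow> successively (\<lambda>x y. y \<noteq> inv_letter x) w"

definition cons_red :: "letter \<Rightarrow> word \<Rightarrow> word" where
  "cons_red x w = (if w \<noteq> [] \<and> hd w = inv_letter x then tl w else x # w)"

definition reduce :: "word \<Rightarrow> word" where
  "reduce w = foldr cons_red w []"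

definition inv_word :: "word \<Rightarrow> word" where
  "inv_word w = rev (map inv_letter w)"

definition F2 :: "word monoid" where
  "F2 = \<lparr>carrier = {w. reduced w}, mult = (\<lambda>u v. reduce (u @ v)), one = []\<rparr>"

definition gen_a :: word where "gen_a = [(Gen_a, True)]"
definition gen_b :: word where "gen_b = [(Gen_b, True)]"

lemma inv_letter_inv [simp]: "inv_letter (inv_letter x) = x"
  by (simp add: inv_letter_def)

lemma inv_letter_neq [simp]: "inv_letter x \<noteq> x" "x \<noteq> inv_letter x"
  by (auto simp: inv_letter_def prod_eq_iff)

lemma inv_letter_eq_iff: "inv_letter x = y \<longleftrightarrow> x = inv_letter y"
  by (metis inv_letter_inv)

lemma inv_word_simps [simp]:
  "inv_word [] = []" "inv_word (x # w) = inv_word w @ [inv_letter x]"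
  "inv_word (u @ v) = inv_word v @ inv_word u"
  by (simp_all add: inv_word_def)

lemma inv_word_inv [simp]: "inv_word (inv_word w) = w"
  by (induction w) auto

lemma reduced_Nil [simp]: "reduced []"
  by (simp add: reduced_def)

lemma reduced_Cons:
  "reduced (x # w) \<longleftrightarrow> reduced w \<and> (w \<noteq> [] \<longrightarrow> hd w \<noteq> inv_letter x)"
  by (auto simp: reduced_def successively_Cons)

lemma reduced_append:
  "reduced (u @ v) \<longleftrightarrow>
     reduced u \<and> reduced v \<and> (u \<noteq> [] \<longrightarrow> v \<noteq> [] \<longrightarrow> hd v \<noteq> inv_letter (last u))"
  by (auto simp: reduced_def successively_append_iff)

lemma reduced_cons_red: "reduced w \<Longrightarrow> reduced (cons_red x w)"
  by (cases w) (auto simp: cons_red_def reduced_Cons)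

lemma cons_red_reduced: "reduced (x # w) \<Longrightarrow> cons_red x w = x # w"
  by (auto simp: cons_red_def reduced_Cons)

lemma cons_red_cancel:
  assumes "reduced w" "y = inv_letter x"
  shows "cons_red y (cons_red x w) = w"
proof (cases "w \<noteq> [] \<and> hd w = inv_letter x")
  case True
  then obtain v where "w = y # v" using assms by (cases w) auto
  with assms show ?thesis by (auto simp: cons_red_def reduced_Cons)
next
  case False
  then show ?thesis using assms by (auto simp: cons_red_def)
qed

lemma foldr_cons_red_reduced: "reduced w \<Longrightarrow> reduced (foldr cons_red u w)"
  by (induction u) (auto intro: reduced_cons_red)

lemma reduced_reduce [simp]: "reduced (reduce w)"
  by (simp add: reduce_def foldr_cons_red_reduced)

lemma reduce_id: "reduced w \<Longrightarrow> reduce w = w"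
  by (induction w) (auto simp: reduce_def cons_red_reduced reduced_Cons)

lemma foldr_cons_red_cons_red:
  assumes "reduced w"
  shows "foldr cons_red (cons_red x u) w = cons_red x (foldr cons_red u w)"
proof (cases "u \<noteq> [] \<and> hd u = inv_letter x")
  case True
  then obtain v where u: "u = inv_letter x # v" by (cases u) auto
  have "cons_red x (cons_red (inv_letter x) (foldr cons_red v w)) = foldr cons_red v w"
    by (rule cons_red_cancel) (auto intro: foldr_cons_red_reduced assms)
  with u show ?thesis by (simp add: cons_red_def)
next
  case False
  then have "cons_red x u = x # u" by (auto simp: cons_red_def)
  then show ?thesis by simp
qed

lemma foldr_reduce: "reduced w \<Longrightarrow> foldr cons_red (reduce u) w = foldr cons_red u w"
  by (induction u) (simp_all add: reduce_def foldr_cons_red_cons_red)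

lemma reduce_append: "reduce (u @ v) = foldr cons_red u (reduce v)"
  by (simp add: reduce_def)

lemma reduce_append_left [simp]: "reduce (reduce u @ v) = reduce (u @ v)"
  by (simp add: reduce_append foldr_reduce)

lemma reduce_append_right [simp]: "reduce (u @ reduce v) = reduce (u @ v)"
  by (simp add: reduce_append reduce_id)

lemma reduce_mid [simp]: "reduce (u @ reduce v @ w) = reduce (u @ v @ w)"
  by (metis reduce_append_left reduce_append_right)

lemma reduce_inv_cancel: "reduce (inv_word u @ u @ w) = reduce w"
proof (induction u arbitrary: w)
  case (Cons x u)
  have "reduce (inv_word (x # u) @ (x # u) @ w)
      = reduce (inv_word u @ reduce (inv_letter x # x # u @ w))" by simp
  also have "reduce (inv_letter x # x # u @ w) = reduce (u @ w)"
    using cons_red_cancel[of "reduce (u @ w)" "inv_letter x" x]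
    by (simp add: reduce_def) (metis cons_red_cancel reduce_def reduced_reduce foldr_append)
  finally show ?case using Cons.IH by simp
qed simp

lemma reduce_inv_cancel': "reduce (u @ inv_word u @ w) = reduce w"
  using reduce_inv_cancel[of "inv_word u" w] by simp

lemma reduced_inv_word: "reduced w \<Longrightarrow> reduced (inv_word w)"
proof (induction w)
  case (Cons x w)
  then show ?case
    by (cases w) (auto simp: reduced_Cons reduced_append)
qed simp

lemma F2_simps [simp]:
  "carrier F2 = {w. reduced w}" "u \<otimes>\<^bsub>F2\<^esub> v = reduce (u @ v)" "\<one>\<^bsub>F2\<^esub> = []"
  by (simp_all add: F2_def)

lemma group_F2: "group F2"
proof (rule groupI)
  fix x assume "x \<in> carrier F2"
  then show "\<exists>y\<in>carrier F2. y \<otimes>\<^bsub>F2\<^esub> x = \<one>\<^bsub>F2\<^esub>"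
    using reduce_inv_cancel[of x "[]"]
    by (intro bexI[of _ "inv_word x"]) (auto simp: reduced_inv_word reduce_def)
qed (auto simp: reduce_id)

lemma inv_F2: "reduced w \<Longrightarrow> inv\<^bsub>F2\<^esub> w = inv_word w"
  using reduce_inv_cancel[of w "[]"]
  by (intro group.inv_equality[OF group_F2]) (auto simp: reduced_inv_word reduce_def)

section \<open>Cyclic length\<close>

definition cyclically_reduced :: "word \<Rightarrow> bool" where
  "cyclically_reduced w \<longleftrightarrow> reduced w \<and> (w \<noteq> [] \<longrightarrow> last w \<noteq> inv_letter (hd w))"

definition conjugate :: "word \<Rightarrow> word \<Rightarrow> bool" where
  "conjugate u w \<longleftrightarrow> (\<exists>g\<in>carrier F2. w = g \<otimes>\<^bsub>F2\<^esub> u \<otimes>\<^bsub>F2\<^esub> inv\<^bsub>F2\<^esub> g)"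

text \<open>The length below is unique by \<open>cyclically_reduced_exists\<close> and \<open>cyclic_length_eq\<close>.\<close>

definition cyclic_length :: "word \<Rightarrow> nat"  ("\<parallel>_\<parallel>") where
  "\<parallel>w\<parallel> = (THE n. \<exists>c. cyclically_reduced c \<and> conjugate w c \<and> length c = n)"

lemma conjugate_alt:
  "conjugate u w \<longleftrightarrow> (\<exists>g. reduced g \<and> w = reduce (g @ u @ inv_word g))"
  by (auto simp: conjugate_def inv_F2)

lemma conjugateI: "w = reduce (g @ u @ inv_word g) \<Longrightarrow> conjugate u w"
proof -
  assume w: "w = reduce (g @ u @ inv_word g)"
  have "reduce (inv_word (reduce g)) = reduce (inv_word g)"
  proof -
    have "reduce (inv_word (reduce g)) = reduce (inv_word (reduce g) @ g @ inv_word g)"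
      using reduce_inv_cancel'[of g "[]"] by (metis append_Nil2 reduce_append_right)
    also have "\<dots> = reduce (inv_word (reduce g) @ reduce g @ inv_word g)"
      by simp
    also have "\<dots> = reduce (inv_word g)" by (rule reduce_inv_cancel)
    finally show ?thesis .
  qed
  then have "w = reduce (reduce g @ u @ inv_word (reduce g))"
    unfolding w by (metis reduce_append_left reduce_append_right append_assoc)
  then show ?thesis unfolding conjugate_alt using reduced_reduce by blast
qed

lemma conjugate_trans:
  assumes "conjugate u v" "conjugate v w" shows "conjugate u w"
proof -
  from assms obtain g h where "v = reduce (g @ u @ inv_word g)" "w = reduce (h @ v @ inv_word h)"
    unfolding conjugate_alt by blast
  then have "w = reduce ((h @ g) @ u @ inv_word (h @ g))" by simp
  then show ?thesis by (rule conjugateI)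
qed

lemma conjugate_sym:
  assumes "conjugate u v" "reduced u" shows "conjugate v u"
proof -
  from assms obtain g where v: "v = reduce (g @ u @ inv_word g)"
    unfolding conjugate_alt by blast
  have "reduce (inv_word g @ v @ inv_word (inv_word g)) = reduce (u @ inv_word g @ g)"
    unfolding v by (simp add: reduce_inv_cancel)
  also have "\<dots> = u"
    using reduce_inv_cancel[of g "[]"] assms(2)
    by (metis append_Nil2 reduce_append_right reduce_id)
  finally show ?thesis by (intro conjugateI[of _ "inv_word g"]) simp
qed

lemma cyclically_reduced_exists:
  "reduced w \<Longrightarrow> \<exists>c. cyclically_reduced c \<and> conjugate w c"
proof (induction w rule: length_induct)
  case (1 w)
  show ?case
  proof (cases "cyclically_reduced w")
    case True
    have "conjugate w w" using 1 by (intro conjugateI[of _ "[]"]) (simp add: reduce_id)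
    with True show ?thesis by blast
  next
    case False
    with 1 have w: "w \<noteq> []" "last w = inv_letter (hd w)" by (auto simp: cyclically_reduced_def)
    then obtain x v where v: "w = x # v" by (cases w) auto
    with w have "v \<noteq> []" "last v = inv_letter x" by (auto split: if_splits)
    then obtain m where m: "w = x # m @ [inv_letter x]" using v
      by (metis append_butlast_last_id)
    have red: "reduced m" using 1 m by (auto simp: reduced_Cons reduced_append)
    have "reduce ([inv_letter x] @ w @ inv_word [inv_letter x]) = m"
      using reduce_inv_cancel[of "[x]"] reduce_inv_cancel[of "[x]" "[]"] red
      by (simp add: m) (metis append_Nil2 append_Cons append_Nil reduce_append_right reduce_id)
    then have "conjugate w m" by (intro conjugateI[of _ "[inv_letter x]"]) simp
    moreover obtain c where "cyclically_reduced c" "conjugate m c"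
      using 1 red m by (metis length_Cons length_append_singleton less_Suc_eq)
    ultimately show ?thesis using conjugate_trans by blast
  qed
qed

lemma cyclically_reduced_rotate:
  "cyclically_reduced (x # c) \<longleftrightarrow> cyclically_reduced (c @ [x])"
proof (cases "c = []")
  case False
  then show ?thesis
    unfolding cyclically_reduced_def reduced_Cons reduced_append
    using inv_letter_eq_iff[of x "last c"] inv_letter_eq_iff[of x "hd c"] by simp metis
qed simp

lemma cyclically_reduced_conj_length:
  assumes "cyclically_reduced c" "reduced g" "cyclically_reduced (reduce (g @ c @ inv_word g))"
  shows "length (reduce (g @ c @ inv_word g)) = length c"
  using assms
proof (induction g arbitrary: c rule: rev_induct)
  case Nil
  then show ?case by (simp add: reduce_id cyclically_reduced_def)
next
  case (snoc x g)
  have g: "reduced g" using snoc.prems by (simp add: reduced_append)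
  consider "c = []" | e where "c = inv_letter x # e" | e where "c = e @ [x]"
    | "c \<noteq> []" "hd c \<noteq> inv_letter x" "last c \<noteq> x"
  proof -
    have "c = inv_letter x # tl c" if "c \<noteq> []" "hd c = inv_letter x"
      using that by (cases c) auto
    moreover have "c = butlast c @ [x]" if "c \<noteq> []" "last c = x"
      using that append_butlast_last_id[of c] by simp
    ultimately show ?thesis using that by blast
  qed
  then show ?case
  proof cases
    case 1
    then show ?thesis using reduce_inv_cancel'[of "g @ [x]" "[]"] by (simp add: reduce_def)
  next
    case (2 e)
    have *: "reduce ((g @ [x]) @ c @ inv_word (g @ [x])) = reduce (g @ (e @ [inv_letter x]) @ inv_word g)"
      using reduce_inv_cancel'[of "[x]" "e @ inv_letter x # inv_word g"]
      by (simp add: 2) (metis reduce_append_right)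
    show ?thesis using snoc.prems snoc.IH[of "e @ [inv_letter x]"] g
      unfolding * unfolding 2 by (simp add: cyclically_reduced_rotate)
  next
    case (3 e)
    have *: "reduce ((g @ [x]) @ c @ inv_word (g @ [x])) = reduce (g @ (x # e) @ inv_word g)"
      using reduce_inv_cancel'[of "[x]" "inv_word g"]
      by (simp add: 3) (metis reduce_append_right append_assoc append_Cons)
    show ?thesis using snoc.prems snoc.IH[of "x # e"] g
      unfolding * unfolding 3 by (simp add: cyclically_reduced_rotate)
  next
    case 4
    let ?d = "(g @ [x]) @ c @ inv_word (g @ [x])"
    have "reduced c" using snoc.prems by (simp add: cyclically_reduced_def)
    then have "reduced ?d"
      using 4 snoc.prems(2) reduced_inv_word[OF snoc.prems(2)]
      by (auto simp: reduced_append reduced_Cons inv_letter_eq_iff)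
    then have d: "reduce ?d = ?d" by (rule reduce_id)
    have "last ?d = inv_letter (hd ?d)" by (cases g) auto
    with snoc.prems(3) show ?thesis unfolding d by (simp add: cyclically_reduced_def)
  qed
qed

lemma cyclic_length_eq:
  assumes "reduced w" "cyclically_reduced c" "conjugate w c"
  shows "\<parallel>w\<parallel> = length c"
  unfolding cyclic_length_def
proof (rule the_equality)
  fix n assume "\<exists>d. cyclically_reduced d \<and> conjugate w d \<and> length d = n"
  then obtain d where d: "cyclically_reduced d" "conjugate w d" "length d = n" by blast
  have "conjugate c d" using assms d conjugate_sym conjugate_trans by blast
  then show "n = length c" using d assms cyclically_reduced_conj_length
    unfolding conjugate_alt by blast
qed (use assms in blast)

section \<open>Automorphisms and chains\<close>

definition letter_image :: "(gen \<Rightarrow> word) \<Rightarrow> letter \<Rightarrow> word" where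
  "letter_image f x = (if snd x then f (fst x) else inv_word (f (fst x)))"

text \<open>The endomorphism of the free group sending each generator \<open>g\<close> to \<open>f g\<close>.\<close>

definition endo_of :: "(gen \<Rightarrow> word) \<Rightarrow> word \<Rightarrow> word" where
  "endo_of f = (\<lambda>w\<in>carrier F2. reduce (concat (map (letter_image f) w)))"

definition sigma :: "word \<Rightarrow> word"  ("\<sigma>") where
  "\<sigma> = endo_of (\<lambda>g. case g of Gen_a \<Rightarrow> gen_a \<otimes>\<^bsub>F2\<^esub> gen_b | Gen_b \<Rightarrow> gen_b)"

definition tau :: "word \<Rightarrow> word"  ("\<tau>") where
  "\<tau> = endo_of (\<lambda>g. case g of Gen_a \<Rightarrow> gen_a | Gen_b \<Rightarrow> gen_b \<otimes>\<^bsub>F2\<^esub> gen_a)"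

abbreviation AutF2 :: "(word \<Rightarrow> word) monoid" where
  "AutF2 \<equiv> AutoGroup F2"

lemma letter_image_inv [simp]: "letter_image f (inv_letter x) = inv_word (letter_image f x)"
  by (simp add: letter_image_def inv_letter_def)

lemma reduce_image_cons_red:
  "reduce (concat (map (letter_image f) (cons_red x w))) =
   reduce (letter_image f x @ concat (map (letter_image f) w))"
  by (cases w) (auto simp: cons_red_def reduce_inv_cancel')

lemma reduce_image_reduce:
  "reduce (concat (map (letter_image f) (reduce w))) = reduce (concat (map (letter_image f) w))"
proof (induction w)
  case (Cons x w)
  have "reduce (x # w) = cons_red x (reduce w)" by (simp add: reduce_def)
  then show ?case using Cons.IH
    by (simp add: reduce_image_cons_red) (metis reduce_append_right)
qed (simp add: reduce_def)

lemma endo_of_hom: "endo_of f \<in> hom F2 F2"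
  by (auto simp: hom_def endo_of_def reduce_image_reduce)

lemma hom_F2_id:
  assumes h: "h \<in> hom F2 F2" and "h gen_a = gen_a" "h gen_b = gen_b" and "reduced w"
  shows "h w = w"
proof -
  interpret group_hom F2 F2 h
    using h group_F2 by (simp add: group_hom_def group_hom_axioms_def)
  have pos: "h [(g, True)] = [(g, True)]" for g
    using assms(2,3) by (cases g) (auto simp: gen_a_def gen_b_def)
  have single: "h [x] = [x]" for x
  proof (cases "snd x")
    case True then show ?thesis using pos[of "fst x"] by (cases x) auto
  next
    case False
    then have "[x] = inv\<^bsub>F2\<^esub> [(fst x, True)]"
      by (cases x) (simp add: inv_F2 reduced_Cons inv_letter_def)
    then show ?thesis using hom_inv[of "[(fst x, True)]"] pos by (simp add: reduced_Cons)
  qed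
  from \<open>reduced w\<close> show ?thesis
  proof (induction w)
    case Nil then show ?case using hom_one by simp
  next
    case (Cons x w)
    then have "x # w = [x] \<otimes>\<^bsub>F2\<^esub> w" by (simp add: reduce_id)
    moreover have "reduced w" using Cons.prems by (simp add: reduced_Cons)
    ultimately show ?case using Cons.IH hom_mult[of "[x]" w] single[of x]
      by (simp add: reduced_Cons)
  qed
qed

lemma endo_of_auto:
  assumes "\<And>x. x \<in> {gen_a, gen_b} \<Longrightarrow> endo_of f (endo_of g x) = x"
    and "\<And>x. x \<in> {gen_a, gen_b} \<Longrightarrow> endo_of g (endo_of f x) = x"
  shows "endo_of f \<in> auto F2"
proof -
  have c: "endo_of f' w \<in> carrier F2" if "w \<in> carrier F2" for f' w
    using endo_of_hom[of f'] that unfolding hom_def by blast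
  have inv: "endo_of f' (endo_of g' w) = w"
    if *: "\<And>x. x \<in> {gen_a, gen_b} \<Longrightarrow> endo_of f' (endo_of g' x) = x" and w: "w \<in> carrier F2" for f' g' w
  proof -
    let ?h = "compose (carrier F2) (endo_of f') (endo_of g')"
    have h: "?h \<in> hom F2 F2"
      by (rule group.hom_compose[OF group_F2 endo_of_hom endo_of_hom])
    have gens: "?h x = x" if "x \<in> {gen_a, gen_b}" for x
    proof -
      have "x \<in> carrier F2" using that by (auto simp: gen_a_def gen_b_def reduced_Cons)
      then show ?thesis by (simp only: compose_eq *[OF that])
    qed
    have "?h w = w"
      by (rule hom_F2_id[OF h gens gens]) (use w in simp_all)
    with w show ?thesis by (simp only: compose_eq)
  qed
  have "bij_betw (endo_of f) (carrier F2) (carrier F2)"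
  proof (rule bij_betw_byWitness[where f' = "endo_of g"])
    show "\<forall>w\<in>carrier F2. endo_of g (endo_of f w) = w"
      using inv[of g f, OF assms(2)] by blast
    show "\<forall>w\<in>carrier F2. endo_of f (endo_of g w) = w"
      using inv[of f g, OF assms(1)] by blast
  qed (use c in blast)+
  moreover have "endo_of f \<in> extensional (carrier F2)"
    unfolding endo_of_def by (rule restrict_extensional)
  ultimately show ?thesis using endo_of_hom[of f] unfolding auto_def Bij_def by blast
qed

lemmas F2_eval_simps = endo_of_def letter_image_def gen_a_def gen_b_def reduce_def cons_red_def
  inv_letter_def inv_word_def reduced_def

lemma sigma_gens: "\<sigma> gen_a = gen_a \<otimes>\<^bsub>F2\<^esub> gen_b" "\<sigma> gen_b = gen_b"
  by (simp_all add: sigma_def F2_eval_simps)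

lemma tau_gens: "\<tau> gen_a = gen_a" "\<tau> gen_b = gen_b \<otimes>\<^bsub>F2\<^esub> gen_a"
  by (simp_all add: tau_def F2_eval_simps)

lemma sigma_auto: "\<sigma> \<in> auto F2"
  unfolding sigma_def
  by (rule endo_of_auto[where g =
        "\<lambda>g. case g of Gen_a \<Rightarrow> gen_a \<otimes>\<^bsub>F2\<^esub> inv_word gen_b | Gen_b \<Rightarrow> gen_b"])
     (auto simp: F2_eval_simps)

lemma tau_auto: "\<tau> \<in> auto F2"
  unfolding tau_def
  by (rule endo_of_auto[where g =
        "\<lambda>g. case g of Gen_a \<Rightarrow> gen_a | Gen_b \<Rightarrow> gen_b \<otimes>\<^bsub>F2\<^esub> inv_word gen_a"])
     (auto simp: F2_eval_simps)

lemma AutF2_mult_apply: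
  "f \<in> auto F2 \<Longrightarrow> g \<in> auto F2 \<Longrightarrow> w \<in> carrier F2 \<Longrightarrow> (f \<otimes>\<^bsub>AutF2\<^esub> g) w = f (g w)"
  by (simp add: AutoGroup_def BijGroup_def auto_def compose_def)

lemma carrier_AutF2 [simp]: "carrier AutF2 = auto F2"
  by (simp add: AutoGroup_def)

lemma group_AutF2: "group AutF2"
  by (rule group.AutoGroup[OF group_F2])

text \<open>A chain is a formal composition, given by its list \<open>[(l\<^sub>1, m\<^sub>1), \<dots>, (l\<^sub>k, m\<^sub>k)]\<close> of
  exponents, so that its length is well defined; the first pair is applied first. The
  empty list and \<open>[(0, 0)]\<close> both give the identity with length 0.\<close>

datatype chain = C1 "(nat \<times> nat) list" | C2 "(nat \<times> nat) list"

fun chain_length :: "chain \<Rightarrow> nat" where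
  "chain_length (C1 lms) = (\<Sum>(l, m)\<leftarrow>lms. m + l)"
| "chain_length (C2 lms) = (\<Sum>(l, m)\<leftarrow>lms. m + l)"

text \<open>\<open>chain_prod e [(l\<^sub>1, m\<^sub>1), \<dots>, (l\<^sub>k, m\<^sub>k)]\<close> is the composition whose factors, from left to right,
  are \<open>\<tau>\<close> to the power \<open>e * m\<^sub>k\<close>, \<open>\<sigma>\<close> to the power \<open>e * l\<^sub>k\<close>, \<open>\<dots>\<close>, \<open>\<tau>\<close> to the power \<open>e * m\<^sub>1\<close>,
  \<open>\<sigma>\<close> to the power \<open>e * l\<^sub>1\<close>.\<close>

fun chain_prod :: "int \<Rightarrow> (nat \<times> nat) list \<Rightarrow> word \<Rightarrow> word" where
  "chain_prod e [] = \<one>\<^bsub>AutF2\<^esub>"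
| "chain_prod e ((l, m) # lms) = chain_prod e lms \<otimes>\<^bsub>AutF2\<^esub>
     (\<tau> [^]\<^bsub>AutF2\<^esub> (e * int m) \<otimes>\<^bsub>AutF2\<^esub> \<sigma> [^]\<^bsub>AutF2\<^esub> (e * int l))"

fun chain_aut :: "chain \<Rightarrow> word \<Rightarrow> word" where
  "chain_aut (C1 lms) = chain_prod 1 lms"
| "chain_aut (C2 lms) = chain_prod (- 1) lms"

definition boundedly_translation_equivalent :: "word \<Rightarrow> word \<Rightarrow> bool" where
  "boundedly_translation_equivalent u v \<longleftrightarrow>
     u \<in> carrier F2 - {\<one>\<^bsub>F2\<^esub>} \<and> v \<in> carrier F2 - {\<one>\<^bsub>F2\<^esub>} \<and>
     (\<exists>C>0::real. \<forall>\<phi>\<in>auto F2.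
        1 / C \<le> real \<parallel>\<phi> u\<parallel> / real \<parallel>\<phi> v\<parallel> \<and> real \<parallel>\<phi> u\<parallel> / real \<parallel>\<phi> v\<parallel> \<le> C)"

end

theory Submission
  imports Defs "HOL-Library.Multiset"
begin

text \<open>Fix a generator \<open>h\<close>, let \<open>g\<close> be the other one, and write a cyclically reduced word containing
  \<open>h\<close> as a cyclic product of syllables \<open>h\<^bsup>\<plusminus>1\<^esup> g\<^bsup>m\<^esup>\<close>. Up to conjugation, the \<open>n\<close>-th power of the twist
  \<open>h \<mapsto> hg\<close> replaces each \<open>m\<close> by \<open>m + n d\<close>, where \<open>d\<close> is \<open>1\<close>, \<open>- 1\<close> or \<open>0\<close> according to the signs
  of the two adjacent letters \<open>h\<close>, and the result is again cyclically reduced. So the cyclic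
  length is the number of syllables plus the sum of all \<open>\<bar>m + n d\<bar>\<close>. Once no gap is opposed
  any more, i.e. once \<open>n d\<close> outweighs every \<open>m\<close> of opposite sign, it is affine in \<open>n\<close>: it is then
  stationary for one step iff it stays bounded, and boundedness passes between \<open>u\<close> and \<open>v\<close>.

  It remains to bound the opposed gaps after a chain \<open>\<psi>\<close> by \<open>\<parallel>u\<parallel> + 1\<close>, whatever the length of \<open>\<psi>\<close>.
  Call two cyclically adjacent letters belonging to different generators a turn if their signs
  differ (for chains of type (C1)) or agree (for type (C2)). No factor of the chain increases the
  number of turns, which is at most \<open>\<parallel>u\<parallel>\<close> initially. A twist of \<open>h\<close> only shrinks the opposed
  powers of \<open>g\<close>, and every subword \<open>hh\<close> or its inverse in the image comes from two turns, so that
  the powers of \<open>h\<close> in the image are short as well.\<close>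

section \<open>Cyclic adjacency\<close>

fun adjacent_pairs :: "'a list \<Rightarrow> ('a \<times> 'a) list" where
  "adjacent_pairs (x # y # zs) = (x, y) # adjacent_pairs (y # zs)"
| "adjacent_pairs zs = []"

text \<open>Repeating the first letter closes the word up, so a one-letter word yields one pair. For
  \<open>c = []\<close> the unspecified \<open>hd []\<close> is harmless: a single letter has no
  adjacent pairs.\<close>

definition cyclic_pairs :: "'a list \<Rightarrow> ('a \<times> 'a) list" where
  "cyclic_pairs c = adjacent_pairs (c @ [hd c])"

lemma adjacent_pairs_append:
  "adjacent_pairs (xs @ y # zs) = adjacent_pairs (xs @ [y]) @ adjacent_pairs (y # zs)"
  by (induction xs rule: adjacent_pairs.induct) auto

lemma length_adjacent_pairs: "length (adjacent_pairs xs) = length xs - 1"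
  by (induction xs rule: adjacent_pairs.induct) auto

lemma length_cyclic_pairs [simp]: "length (cyclic_pairs c) = length c"
  by (simp add: cyclic_pairs_def length_adjacent_pairs)

lemma adjacent_pairs_replicate_snoc:
  "adjacent_pairs (replicate (Suc j) x @ [y]) = replicate j (x, x) @ [(x, y)]"
  by (induction j) auto

text \<open>Both cyclic words consist of the same two arcs, from the head of \<open>xs\<close> to
  that of \<open>ys\<close> and back. Hence anything read off from this multiset is invariant under
  rotation.\<close>

lemma cyclic_pairs_swap: "mset (cyclic_pairs (xs @ ys)) = mset (cyclic_pairs (ys @ xs))"
proof (cases "xs = [] \<or> ys = []")
  case False
  then obtain x xs' y ys' where "xs = x # xs'" "ys = y # ys'"
    by (meson neq_Nil_conv)
  then show ?thesis
    using adjacent_pairs_append[of xs y "ys' @ [x]"] adjacent_pairs_append[of ys x "xs' @ [y]"]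
    by (simp add: cyclic_pairs_def)
qed auto

lemma reduced_iff_adjacent_pairs:
  "reduced w \<longleftrightarrow> (\<forall>(x, y)\<in>set (adjacent_pairs w). y \<noteq> inv_letter x)"
  by (induction w rule: adjacent_pairs.induct) (auto simp: reduced_Cons)

text \<open>Being cyclically reduced means that \<open>c @ [hd c]\<close> is reduced: the added pair
  is exactly the condition on the last and first letters.\<close>

lemma cyclically_reduced_iff_cyclic_pairs:
  "cyclically_reduced c \<longleftrightarrow> (\<forall>(x, y)\<in>set (cyclic_pairs c). y \<noteq> inv_letter x)"
proof (cases "c = []")
  case False
  then have "cyclically_reduced c \<longleftrightarrow> reduced (c @ [hd c])"
    using inv_letter_eq_iff[of "hd c" "last c"]
    by (auto simp: cyclically_reduced_def reduced_append reduced_Cons)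
  then show ?thesis by (simp only: reduced_iff_adjacent_pairs cyclic_pairs_def)
qed (simp add: cyclic_pairs_def cyclically_reduced_def)

lemma cyclically_reduced_swap:
  "cyclically_reduced (xs @ ys) \<longleftrightarrow> cyclically_reduced (ys @ xs)"
  using mset_eq_setD[OF cyclic_pairs_swap[of xs ys]]
  by (simp add: cyclically_reduced_iff_cyclic_pairs)

lemma conjugate_swap: "reduced (ys @ xs) \<Longrightarrow> conjugate (xs @ ys) (ys @ xs)"
  by (rule conjugateI[of _ "inv_word xs"]) (simp add: reduce_inv_cancel reduce_id)

section \<open>Powers of a generator\<close>

text \<open>The reduced word of the power of \<open>g\<close> with exponent \<open>m\<close>; for
  \<open>m = 0\<close> the chosen sign does not appear.\<close>

definition gpow :: "gen \<Rightarrow> int \<Rightarrow> word" where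
  "gpow g m = replicate (nat \<bar>m\<bar>) (g, 0 \<le> m)"

lemma length_gpow [simp]: "length (gpow g m) = nat \<bar>m\<bar>"
  by (simp add: gpow_def)

lemma gpow_0 [simp]: "gpow g 0 = []"
  by (simp add: gpow_def)

lemma gpow_1 [simp]: "gpow g 1 = [(g, True)]"
  by (simp add: gpow_def)

lemma set_gpow: "x \<in> set (gpow g m) \<Longrightarrow> fst x = g"
  by (auto simp: gpow_def)

lemma gpow_Cons_True: "0 \<le> m \<Longrightarrow> gpow g (m + 1) = (g, True) # gpow g m"
proof -
  assume "0 \<le> m"
  then have "nat \<bar>m + 1\<bar> = Suc (nat \<bar>m\<bar>)" by simp
  then show ?thesis using \<open>0 \<le> m\<close> by (simp add: gpow_def)
qed

lemma gpow_Cons_False: "m \<le> 0 \<Longrightarrow> gpow g (m - 1) = (g, False) # gpow g m"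
proof -
  assume m: "m \<le> 0"
  then have "nat \<bar>m - 1\<bar> = Suc (nat \<bar>m\<bar>)" by simp
  then show ?thesis using m by (cases "m = 0") (simp_all add: gpow_def)
qed

lemma reduced_gpow: "reduced (gpow g m)"
proof -
  have "reduced (replicate n x)" for n and x :: letter
    by (induction n) (auto simp: reduced_Cons hd_replicate)
  then show ?thesis by (simp add: gpow_def)
qed

lemma inv_word_gpow [simp]: "inv_word (gpow g m) = gpow g (- m)"
  by (cases "m = 0") (auto simp: gpow_def inv_word_def inv_letter_def)

lemma reduce_Cons_gpow:
  "reduce ((g, b) # gpow g m) = gpow g (m + (if b then 1 else - 1))"
proof -
  have *: "reduce ((g, b) # gpow g m) = cons_red (g, b) (gpow g m)"
    using reduce_id[OF reduced_gpow[of g m]] by (simp add: reduce_def)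
  show ?thesis
  proof (cases b)
    case True
    then show ?thesis
    proof (cases "0 \<le> m")
      case False
      then have "gpow g m = (g, False) # gpow g (m + 1)" using gpow_Cons_False[of "m + 1" g] by simp
      then show ?thesis using True * by (simp add: cons_red_def inv_letter_def)
    next
      case m: True
      have "reduced ((g, True) # gpow g m)"
        using reduced_gpow[of g "m + 1"] gpow_Cons_True[OF m] by simp
      then show ?thesis using True m by (simp add: reduce_id gpow_Cons_True)
    qed
  next
    case False
    show ?thesis
    proof (cases "m \<le> 0")
      case m: False
      then have "gpow g m = (g, True) # gpow g (m - 1)" using gpow_Cons_True[of "m - 1" g] by simp
      then show ?thesis using False * by (simp add: cons_red_def inv_letter_def)
    next
      case m: True
      have "reduced ((g, False) # gpow g m)"
        using reduced_gpow[of g "m - 1"] gpow_Cons_False[OF m] by simp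
      then show ?thesis using False m by (simp add: reduce_id gpow_Cons_False)
    qed
  qed
qed

lemma reduce_gpow_append: "reduce (gpow g m @ gpow g n) = gpow g (m + n)"
proof -
  have "reduce (replicate j (g, b) @ gpow g n) = gpow g (n + (if b then int j else - int j))" for j b
  proof (induction j)
    case (Suc j)
    have "reduce (replicate (Suc j) (g, b) @ gpow g n)
        = reduce ([(g, b)] @ reduce (replicate j (g, b) @ gpow g n))"
      by (simp only: reduce_append_right) simp
    then show ?case using Suc.IH by (simp add: reduce_Cons_gpow algebra_simps)
  qed (simp add: reduce_id reduced_gpow)
  from this[of "nat \<bar>m\<bar>" "0 \<le> m"] show ?thesis by (simp add: gpow_def add.commute)
qed

lemma reduce_gpow_append_append: "reduce (gpow g m @ gpow g n @ w) = reduce (gpow g (m + n) @ w)"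
  by (metis append_assoc reduce_append_left reduce_gpow_append)

section \<open>Syllable decompositions\<close>

fun other :: "gen \<Rightarrow> gen" where
  "other Gen_a = Gen_b" | "other Gen_b = Gen_a"

lemma other_neq [simp]: "other h \<noteq> h" "h \<noteq> other h"
  by (cases h; simp)+

lemma neq_other: "g \<noteq> h \<Longrightarrow> g = other h"
  by (cases g; cases h) auto

definition syllable_word :: "gen \<Rightarrow> (bool \<times> int) list \<Rightarrow> word" where
  "syllable_word h S = concat (map (\<lambda>(e, m). (h, e) # gpow (other h) m) S)"

text \<open>\<open>t\<close> is the sign of the letter following the last syllable.\<close>

fun gaps :: "(bool \<times> int) list \<Rightarrow> bool \<Rightarrow> (bool \<times> int \<times> bool) list" where
  "gaps [] t = []"
| "gaps ((e, m) # S) t = (e, m, if S = [] then t else fst (hd S)) # gaps S t"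

definition cyclic_gaps :: "(bool \<times> int) list \<Rightarrow> (bool \<times> int \<times> bool) list" where
  "cyclic_gaps S = gaps S (fst (hd S))"

text \<open>The pairs met on the way from one letter of generator \<open>h\<close> to the next, so
  that each cyclic pair belongs to exactly one gap and counting pairs becomes a sum over
  gaps.\<close>

fun gap_pairs :: "gen \<Rightarrow> bool \<times> int \<times> bool \<Rightarrow> (letter \<times> letter) list" where
  "gap_pairs h (e, m, e') = (if m = 0 then [((h, e), (h, e'))]
     else let x = (other h, 0 \<le> m) in
       ((h, e), x) # replicate (nat \<bar>m\<bar> - 1) (x, x) @ [(x, (h, e'))])"

lemma syllable_word_simps [simp]:
  "syllable_word h [] = []"
  "syllable_word h ((e, m) # S) = (h, e) # gpow (other h) m @ syllable_word h S"
  by (simp_all add: syllable_word_def)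

lemma hd_syllable_word: "S \<noteq> [] \<Longrightarrow> hd (syllable_word h S) = (h, fst (hd S))"
  by (cases S) auto

lemma length_syllable_word:
  "int (length (syllable_word h S)) = int (length S) + (\<Sum>(e, m)\<leftarrow>S. \<bar>m\<bar>)"
  by (induction S) auto

lemma gap_pairs_eq: "adjacent_pairs ((h, e) # gpow (other h) m @ [(h, e')]) = gap_pairs h (e, m, e')"
proof (cases "m = 0")
  case False
  then obtain j where "nat \<bar>m\<bar> = Suc j" by (metis gr0_implies_Suc zero_less_abs_iff zero_less_nat_eq)
  then show ?thesis using False adjacent_pairs_replicate_snoc[of j "(other h, 0 \<le> m)" "(h, e')"]
    by (simp add: gpow_def Let_def)
qed simp

lemma adjacent_pairs_syllable_word:
  "adjacent_pairs (syllable_word h S @ [(h, t)]) = concat (map (gap_pairs h) (gaps S t))"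
proof (induction S)
  case (Cons s S)
  obtain e m where s: "s = (e, m)" by (cases s)
  show ?case
  proof (cases S)
    case Nil
    then show ?thesis using gap_pairs_eq[of h e m t] s by simp
  next
    case (Cons s' S')
    obtain e' m' where s': "s' = (e', m')" by (cases s')
    have "adjacent_pairs (syllable_word h (s # S) @ [(h, t)])
       = adjacent_pairs (((h, e) # gpow (other h) m) @ (h, e') # (gpow (other h) m' @ syllable_word h S' @ [(h, t)]))"
      by (simp add: s s' Cons)
    also have "\<dots> = gap_pairs h (e, m, e') @ adjacent_pairs (syllable_word h S @ [(h, t)])"
      by (subst adjacent_pairs_append) (use gap_pairs_eq[of h e m e'] in \<open>simp add: s' Cons\<close>)
    finally show ?thesis using Cons.IH by (simp add: s s' Cons)
  qed
qed simp

lemma cyclic_pairs_syllable_word: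
  "S \<noteq> [] \<Longrightarrow> cyclic_pairs (syllable_word h S) = concat (map (gap_pairs h) (cyclic_gaps S))"
  unfolding cyclic_pairs_def cyclic_gaps_def
  by (simp add: hd_syllable_word adjacent_pairs_syllable_word)

text \<open>Letters of different generators never cancel, nor do letters within one power, so a
  cancellation needs an empty gap between opposite signs.\<close>

lemma cyclically_reduced_syllable_word:
  assumes "S \<noteq> []"
  shows "cyclically_reduced (syllable_word h S) \<longleftrightarrow>
    (\<forall>(e, m, e')\<in>set (cyclic_gaps S). e \<noteq> e' \<longrightarrow> m \<noteq> 0)"
proof -
  have "(\<forall>(x, y)\<in>set (gap_pairs h (e, m, e')). y \<noteq> inv_letter x) \<longleftrightarrow> (e \<noteq> e' \<longrightarrow> m \<noteq> 0)" for e m e'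
    by (auto simp: inv_letter_def Let_def)
  then have "(\<forall>(x, y)\<in>set (gap_pairs h p). y \<noteq> inv_letter x) \<longleftrightarrow>
      (case p of (e, m, e') \<Rightarrow> e \<noteq> e' \<longrightarrow> m \<noteq> 0)" for p
    by (cases p) simp
  then show ?thesis
    by (simp add: cyclically_reduced_iff_cyclic_pairs cyclic_pairs_syllable_word[OF assms]
        del: gap_pairs.simps)
qed

lemma length_filter_concat:
  "length (filter P (concat xss)) = (\<Sum>xs\<leftarrow>xss. length (filter P xs))"
  by (induction xss) auto

lemma reduced_syllable_form: "reduced w \<Longrightarrow> \<exists>m S. w = gpow (other h) m @ syllable_word h S"
proof (induction w)
  case Nil
  have "[] = gpow (other h) 0 @ syllable_word h []" by simp
  then show ?case by blast
next
  case (Cons x w)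
  then obtain m S where w: "w = gpow (other h) m @ syllable_word h S"
    by (auto simp: reduced_Cons)
  show ?case
  proof (cases "fst x = h")
    case True
    then have "x # w = gpow (other h) 0 @ syllable_word h ((snd x, m) # S)" using w by (cases x) auto
    then show ?thesis by blast
  next
    case False
    then obtain b where x: "x = (other h, b)" using neq_other by (cases x) auto
    \<comment> \<open>A letter of sign opposite to the leading power would cancel with it, so it can
      only lengthen that power.\<close>
    have "if b then 0 \<le> m else m \<le> 0"
    proof (rule ccontr)
      assume *: "\<not> ?thesis"
      then have "m \<noteq> 0" by (auto split: if_splits)
      then have "w \<noteq> []" "hd w = (other h, 0 \<le> m)"
        using w by (auto simp: gpow_def hd_append)
      then show False using Cons.prems * x
        by (auto simp: reduced_Cons inv_letter_def split: if_splits)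
    qed
    then have "x # w = gpow (other h) (m + (if b then 1 else - 1)) @ syllable_word h S"
      using w x gpow_Cons_True[of m] gpow_Cons_False[of m] by (auto split: if_splits)
    then show ?thesis by blast
  qed
qed

lemma syllable_form_exists:
  assumes "cyclically_reduced c" "x \<in> set c" "fst x = h"
  shows "\<exists>xs ys S. c = xs @ ys \<and> S \<noteq> [] \<and> ys @ xs = syllable_word h S"
proof -
  obtain xs ys where c: "c = xs @ x # ys" using assms(2) by (meson split_list)
  have "cyclically_reduced ((x # ys) @ xs)"
    using assms(1) cyclically_reduced_swap[of xs "x # ys"] c by simp
  then have "reduced (ys @ xs)" by (simp add: cyclically_reduced_def reduced_Cons)
  then obtain m S where "ys @ xs = gpow (other h) m @ syllable_word h S"
    using reduced_syllable_form by blast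
  \<comment> \<open>Rotating \<open>x\<close> to the front turns the stray leading power into the
    power of its syllable.\<close>
  then have "(x # ys) @ xs = syllable_word h ((snd x, m) # S)" using assms(3) by (cases x) simp
  then show ?thesis using c by blast
qed

section \<open>Twists\<close>

definition twist_gens :: "gen \<Rightarrow> int \<Rightarrow> gen \<Rightarrow> word" where
  "twist_gens h n x = (if x = h then (h, True) # gpow (other h) n else [(x, True)])"

definition twist :: "gen \<Rightarrow> int \<Rightarrow> word \<Rightarrow> word" where
  "twist h n = endo_of (twist_gens h n)"

lemma conjugate_endo_of:
  assumes "conjugate u v" "reduced u" shows "conjugate (endo_of f u) (endo_of f v)"
proof -
  interpret group_hom F2 F2 "endo_of f"
    using endo_of_hom group_F2 by (simp add: group_hom_def group_hom_axioms_def)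
  obtain g where g: "g \<in> carrier F2" "v = g \<otimes>\<^bsub>F2\<^esub> u \<otimes>\<^bsub>F2\<^esub> inv\<^bsub>F2\<^esub> g"
    using assms(1) unfolding conjugate_def by blast
  have u: "u \<in> carrier F2" using assms(2) by simp
  have "endo_of f v = endo_of f g \<otimes>\<^bsub>F2\<^esub> endo_of f u \<otimes>\<^bsub>F2\<^esub> inv\<^bsub>F2\<^esub> endo_of f g"
    unfolding g(2) using g(1) u by (simp only: hom_mult hom_inv G.m_closed G.inv_closed)
  then show ?thesis unfolding conjugate_def using hom_closed[OF g(1)] by blast
qed

lemma endo_of_apply: "reduced w \<Longrightarrow> endo_of f w = reduce (concat (map (letter_image f) w))"
  by (simp add: endo_of_def)

lemma reduced_endo_of: "reduced w \<Longrightarrow> reduced (endo_of f w)"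
  by (simp add: endo_of_apply)

lemma reduced_twist: "reduced w \<Longrightarrow> reduced (twist h n w)"
  by (simp add: twist_def reduced_endo_of)

lemma twist_other_letters:
  assumes "\<forall>x\<in>set w. fst x \<noteq> h"
  shows "concat (map (letter_image (twist_gens h n)) w) = w"
  using assms by (induction w) (auto simp: letter_image_def twist_gens_def inv_letter_def)

text \<open>The coefficient with which a gap moves. With \<open>g = other h\<close>, a positive
  letter before the gap leaves the \<open>n\<close>-th power of \<open>g\<close> on its right; an
  inverse letter after the gap leaves the inverse of that power on its left.\<close>

definition jump :: "bool \<Rightarrow> bool \<Rightarrow> int" where
  "jump e e' = of_bool e - of_bool (\<not> e')"

definition shift :: "int \<Rightarrow> (bool \<times> int) list \<Rightarrow> (bool \<times> int) list" where
  "shift n S = map (\<lambda>(e, m, e'). (e, m + n * jump e e')) (cyclic_gaps S)"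

lemma reduce_cong_right: "reduce v = reduce v' \<Longrightarrow> reduce (u @ v) = reduce (u @ v')"
  by (metis reduce_append_right)

lemma reduce_cong_left: "reduce v = reduce v' \<Longrightarrow> reduce (v @ u) = reduce (v' @ u)"
  by (metis reduce_append_left)

text \<open>Each letter \<open>(h, False)\<close> hands the power created on its left over to the preceding
  gap; the correction terms at both ends are what is handed over at the ends of the word.\<close>

lemma reduce_twist_syllable_word:
  fixes n h
  defines "corr \<equiv> (\<lambda>e. gpow (other h) (if e then 0 else - n))"
  shows "reduce (concat (map (letter_image (twist_gens h n)) (syllable_word h S)) @ corr t) =
    reduce (corr (if S = [] then t else fst (hd S)) @
      syllable_word h (map (\<lambda>(e, m, e'). (e, m + n * jump e e')) (gaps S t)))"
proof (induction S)
  case (Cons s S)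
  obtain e m where s: "s = (e, m)" by (cases s)
  define t' where "t' = (if S = [] then t else fst (hd S))"
  define img where "img = (\<lambda>w. concat (map (letter_image (twist_gens h n)) w))"
  define S' where "S' = map (\<lambda>(e, m, e'). (e, m + n * jump e e')) (gaps S t)"
  let ?post = "gpow (other h) (if e then n else 0)"
  have IH: "reduce (img (syllable_word h S) @ corr t) = reduce (corr t' @ syllable_word h S')"
    using Cons.IH by (simp add: t'_def img_def S'_def)
  have h: "letter_image (twist_gens h n) (h, e) = corr e @ (h, e) # ?post"
    by (simp add: letter_image_def twist_gens_def corr_def inv_letter_def)
  have g: "img (gpow (other h) m) = gpow (other h) m"
    unfolding img_def by (rule twist_other_letters) (auto dest: set_gpow)
  have "img (syllable_word h (s # S)) @ corr t
      = (corr e @ (h, e) # ?post @ gpow (other h) m) @ img (syllable_word h S) @ corr t"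
    using g by (simp add: s h img_def)
  also have "reduce \<dots> = reduce ((corr e @ (h, e) # ?post @ gpow (other h) m) @ corr t' @ syllable_word h S')"
    using IH by (rule reduce_cong_right)
  also have "\<dots> = reduce ((corr e @ [(h, e)]) @ ?post @ gpow (other h) m @ corr t' @ syllable_word h S')"
    by simp
  also have "\<dots> = reduce ((corr e @ [(h, e)]) @ gpow (other h) (m + n * jump e t') @ syllable_word h S')"
  proof (rule reduce_cong_right)
    have "reduce (?post @ gpow (other h) m @ corr t' @ syllable_word h S')
       = reduce (gpow (other h) ((if e then n else 0) + m + (if t' then 0 else - n)) @ syllable_word h S')"
      unfolding corr_def by (simp only: reduce_gpow_append_append)
    also have "(if e then n else 0) + m + (if t' then 0 else - n) = m + n * jump e t'"
      by (simp add: jump_def)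
    finally show "reduce (?post @ gpow (other h) m @ corr t' @ syllable_word h S')
      = reduce (gpow (other h) (m + n * jump e t') @ syllable_word h S')" .
  qed
  finally show ?case by (simp add: s img_def S'_def t'_def)
qed simp

lemma gaps_shift:
  "gaps (map (\<lambda>(e, m, e'). (e, m + n * jump e e')) (gaps S t)) t
     = map (\<lambda>(e, m, e'). (e, m + n * jump e e', e')) (gaps S t)"
proof (induction S)
  case (Cons s S)
  then show ?case by (cases s; cases S) auto
qed simp

lemma shift_eq_Nil_iff [simp]: "shift n S = [] \<longleftrightarrow> S = []"
  by (cases S) (auto simp: shift_def cyclic_gaps_def)

lemma cyclic_gaps_shift:
  "cyclic_gaps (shift n S) = map (\<lambda>(e, m, e'). (e, m + n * jump e e', e')) (cyclic_gaps S)"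
proof -
  have "fst (hd (shift n S)) = fst (hd S)" if "S \<noteq> []"
    using that by (cases S) (auto simp: shift_def cyclic_gaps_def)
  then have "cyclic_gaps (shift n S) = gaps (shift n S) (fst (hd S))"
    by (cases "S = []") (simp_all add: cyclic_gaps_def shift_def)
  then show ?thesis unfolding shift_def cyclic_gaps_def by (simp only: gaps_shift)
qed

text \<open>Only gaps between opposite signs must stay nonempty, and there \<open>jump\<close>
  vanishes, so these gaps do not move.\<close>

lemma cyclically_reduced_shift:
  assumes "S \<noteq> []" "cyclically_reduced (syllable_word h S)"
  shows "cyclically_reduced (syllable_word h (shift n S))"
proof -
  have "m + n * jump e e' \<noteq> 0" if "(e, m, e') \<in> set (cyclic_gaps S)" "e \<noteq> e'" for e m e'
  proof -
    have "m \<noteq> 0" using assms(2) that unfolding cyclically_reduced_syllable_word[OF assms(1)] by fastforce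
    moreover have "jump e e' = 0" using that(2) by (auto simp: jump_def)
    ultimately show ?thesis by simp
  qed
  then have "\<forall>(e, m, e')\<in>set (cyclic_gaps (shift n S)). e \<noteq> e' \<longrightarrow> m \<noteq> 0"
    unfolding cyclic_gaps_shift by auto
  with assms(1) show ?thesis by (simp add: cyclically_reduced_syllable_word)
qed

lemma conjugate_twist_syllable_word:
  assumes "S \<noteq> []" "cyclically_reduced (syllable_word h S)"
  shows "conjugate (twist h n (syllable_word h S)) (syllable_word h (shift n S))"
proof -
  let ?g = "gpow (other h) (if fst (hd S) then 0 else - n)"
  let ?v = "syllable_word h (shift n S)" and ?u = "syllable_word h S"
  let ?i = "concat (map (letter_image (twist_gens h n)) ?u)"
  have red: "reduced ?u" "reduced ?v"
    using assms cyclically_reduced_shift[OF assms] by (auto simp: cyclically_reduced_def)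
  \<comment> \<open>Taking for \<open>t\<close> the sign of the first letter makes the corrections
    at both ends equal, so together they amount to a conjugation by \<open>?g\<close>.\<close>
  have "reduce (?i @ ?g) = reduce (?g @ ?v)"
    using reduce_twist_syllable_word[where h = h and n = n and S = S and t = "fst (hd S)"] assms(1)
    by (simp add: shift_def cyclic_gaps_def)
  then have "reduce (inv_word ?g @ reduce ?i @ inv_word (inv_word ?g)) = reduce (inv_word ?g @ ?g @ ?v)"
    unfolding inv_word_inv reduce_mid by (rule reduce_cong_right)
  also have "\<dots> = ?v" using red by (simp only: reduce_inv_cancel reduce_id)
  finally show ?thesis using red
    unfolding twist_def endo_of_apply[OF red(1)] by (intro conjugateI[of _ "inv_word ?g"]) (rule sym)
qed

section \<open>Sign turns and opposed gaps\<close>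

text \<open>\<open>s = True\<close> stands for type (C1) and \<open>s = False\<close> for type (C2);
  \<open>dir s\<close> is the common sign of the exponents.\<close>

definition dir :: "bool \<Rightarrow> int" where
  "dir s = (if s then 1 else - 1)"

definition is_turn :: "bool \<Rightarrow> letter \<times> letter \<Rightarrow> bool" where
  "is_turn s = (\<lambda>(x, y). fst x \<noteq> fst y \<and> (snd x \<noteq> snd y) = s)"

definition turns :: "bool \<Rightarrow> word \<Rightarrow> nat" where
  "turns s c = length (filter (is_turn s) (cyclic_pairs c))"

definition is_run :: "gen \<Rightarrow> letter \<times> letter \<Rightarrow> bool" where
  "is_run g = (\<lambda>(x, y). x = y \<and> fst x = g)"

definition runs :: "gen \<Rightarrow> word \<Rightarrow> nat" where
  "runs g c = length (filter (is_run g) (cyclic_pairs c))"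

text \<open>Since \<open>jump\<close> is 0, 1 or -1, the product is negative only for a power
  opposed to the twist, and then it is minus the length of that power. The first alternative covers
  words without syllable form.\<close>

definition opposition_le :: "int \<Rightarrow> bool \<Rightarrow> gen \<Rightarrow> word \<Rightarrow> bool" where
  "opposition_le k s h c \<longleftrightarrow> (\<forall>x\<in>set c. fst x \<noteq> h) \<or>
     (\<exists>xs ys S. c = xs @ ys \<and> S \<noteq> [] \<and> ys @ xs = syllable_word h S \<and>
       (\<forall>(e, m, e')\<in>set (cyclic_gaps S). - k \<le> dir s * (m * jump e e')))"

lemma length_filter_cyclic_pairs_swap:
  "length (filter P (cyclic_pairs (xs @ ys))) = length (filter P (cyclic_pairs (ys @ xs)))"
  by (metis cyclic_pairs_swap mset_filter size_mset)

lemma turns_le_length: "turns s c \<le> length c"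
  unfolding turns_def by (metis length_cyclic_pairs length_filter_le)

lemma runs_le_length: "runs g c \<le> length c"
  unfolding runs_def by (metis length_cyclic_pairs length_filter_le)

lemma length_filter_syllable_word:
  "S \<noteq> [] \<Longrightarrow> length (filter P (cyclic_pairs (syllable_word h S))) =
     (\<Sum>p\<leftarrow>cyclic_gaps S. length (filter P (gap_pairs h p)))"
  by (simp add: cyclic_pairs_syllable_word length_filter_concat comp_def del: gap_pairs.simps)

lemma length_filter_turn_gap:
  "length (filter (is_turn s) (gap_pairs h (e, m, e'))) =
    (if m = 0 then 0 else of_bool ((e \<noteq> (0 \<le> m)) = s) + of_bool (((0 \<le> m) \<noteq> e') = s))"
  by (auto simp: Let_def is_turn_def)

lemma length_filter_run_gap:
  "length (filter (is_run h) (gap_pairs h (e, m, e'))) = of_bool (m = 0 \<and> e = e')"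
  "length (filter (is_run (other h)) (gap_pairs h (e, m, e'))) = nat \<bar>m\<bar> - 1"
  by (auto simp: Let_def is_run_def)

text \<open>If \<open>e = e'\<close>, the gap has two turns when its power is opposed to direction
  \<open>s\<close> and none otherwise, and the twist moves the power away from opposition. If
  \<open>e\<close> and \<open>e'\<close> differ, nothing moves.\<close>

lemma turns_gap_shift_le:
  assumes "0 \<le> l"
  shows "length (filter (is_turn s) (gap_pairs h (e, m + dir s * l * jump e e', e')))
    \<le> length (filter (is_turn s) (gap_pairs h (e, m, e')))"
  using assms unfolding length_filter_turn_gap dir_def jump_def
  by (cases s; cases e; cases e') auto

text \<open>A twist in direction \<open>s\<close> closes a gap only if the gap was opposed to \<open>s\<close>, and then
  it contributed two turns.\<close>

lemma runs_gap_shift_le: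
  assumes "0 < l" "e \<noteq> e' \<longrightarrow> m \<noteq> 0"
  shows "2 * length (filter (is_run h) (gap_pairs h (e, m + dir s * l * jump e e', e')))
    \<le> length (filter (is_turn s) (gap_pairs h (e, m, e')))"
  using assms unfolding length_filter_turn_gap length_filter_run_gap dir_def jump_def
  by (cases s; cases e; cases e') auto

lemma turns_shift_le:
  assumes "0 \<le> l" "S \<noteq> []"
  shows "turns s (syllable_word h (shift (dir s * l) S)) \<le> turns s (syllable_word h S)"
  unfolding turns_def
  by (simp add: length_filter_syllable_word assms cyclic_gaps_shift comp_def del: gap_pairs.simps)
     (rule sum_list_mono, use turns_gap_shift_le[OF assms(1)] in auto)

text \<open>Summing over gaps bounds the new runs of \<open>h\<close> by the old turns. This needs a
  proper twist, \<open>0 < l\<close>: a power of \<open>h\<close> has runs but no turns.\<close>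

lemma runs_shift_le:
  assumes "0 < l" "S \<noteq> []" "cyclically_reduced (syllable_word h S)"
  shows "2 * runs h (syllable_word h (shift (dir s * l) S)) \<le> turns s (syllable_word h S)"
proof -
  have "(\<Sum>p\<leftarrow>cyclic_gaps S. 2 * length (filter (is_run h)
        (gap_pairs h (case p of (e, m, e') \<Rightarrow> (e, m + dir s * l * jump e e', e')))))
     \<le> (\<Sum>p\<leftarrow>cyclic_gaps S. length (filter (is_turn s) (gap_pairs h p)))"
  proof (rule sum_list_mono)
    fix p assume p: "p \<in> set (cyclic_gaps S)"
    obtain e m e' where [simp]: "p = (e, m, e')" by (cases p)
    have "e \<noteq> e' \<longrightarrow> m \<noteq> 0"
      using p assms(3) cyclically_reduced_syllable_word[OF assms(2), of h] by auto
    from runs_gap_shift_le[OF assms(1) this]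
    show "2 * length (filter (is_run h)
        (gap_pairs h (case p of (e, m, e') \<Rightarrow> (e, m + dir s * l * jump e e', e'))))
      \<le> length (filter (is_turn s) (gap_pairs h p))"
      by (simp del: gap_pairs.simps)
  qed
  then show ?thesis unfolding runs_def turns_def
    by (simp add: length_filter_syllable_word assms(2) cyclic_gaps_shift comp_def
        sum_list_const_mult del: gap_pairs.simps)
qed

text \<open>A nonempty power with exponent \<open>m\<close> contains
  \<open>\<bar>m\<bar> - 1\<close> runs, hence \<open>\<bar>m\<bar>\<close> is at most the number of
  runs plus one. This is the source of the \<open>+ 1\<close> in \<open>k\<close>.\<close>

lemma opposition_le_if_runs:
  assumes "cyclically_reduced c" "int (runs (other h) c) + 1 \<le> k"
  shows "opposition_le k s h c"
proof (cases "\<forall>x\<in>set c. fst x \<noteq> h")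
  case False
  then obtain xs ys S where c: "c = xs @ ys" "S \<noteq> []" "ys @ xs = syllable_word h S"
    using syllable_form_exists[OF assms(1)] by blast
  have "- k \<le> dir s * (m * jump e e')" if "(e, m, e') \<in> set (cyclic_gaps S)" for e m e'
  proof -
    have "nat \<bar>m\<bar> - 1 \<le> runs (other h) (syllable_word h S)"
      unfolding runs_def length_filter_syllable_word[OF c(2)] length_filter_run_gap(2)[symmetric, of m h e e']
      using that by (intro member_le_sum_list) (auto simp del: gap_pairs.simps)
    also have "\<dots> = runs (other h) c"
      unfolding runs_def c(1) c(3)[symmetric] by (rule length_filter_cyclic_pairs_swap)
    finally have "\<bar>m\<bar> \<le> k" using assms(2) by linarith
    then show ?thesis by (auto simp: dir_def jump_def)
  qed
  then show ?thesis unfolding opposition_le_def using c by blast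
qed (simp add: opposition_le_def)

section \<open>Twists as one-parameter groups of automorphisms containing the powers of
  \<open>\<sigma>\<close> and \<open>\<tau>\<close>\<close>

lemma twist_0: "reduced w \<Longrightarrow> twist h 0 w = w"
proof -
  have "letter_image (twist_gens h 0) x = [x]" for x
    by (cases x) (simp add: letter_image_def twist_gens_def inv_letter_def)
  then have "concat (map (letter_image (twist_gens h 0)) w) = w"
    by (induction w) auto
  then show "reduced w \<Longrightarrow> twist h 0 w = w" by (simp add: twist_def endo_of_apply reduce_id)
qed

text \<open>A twist fixes the letters of \<open>other h\<close>, so on a single letter the exponents
  of the attached powers add up; the general case follows letter by letter.\<close>

lemma twist_add:
  assumes "reduced w" shows "twist h m (twist h n w) = twist h (m + n) w"
proof -
  define img where "img = (\<lambda>n w. concat (map (letter_image (twist_gens h n)) w))"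
  have append: "img n (u @ v) = img n u @ img n v" for n u v by (simp add: img_def)
  have g: "img m (gpow (other h) i) = gpow (other h) i" for i
    unfolding img_def by (rule twist_other_letters) (auto dest: set_gpow)
  have letter: "reduce (img m (img n [x])) = reduce (img (m + n) [x])" for x
  proof (cases "fst x = h")
    case False
    then have "img i [x] = [x]" for i
      unfolding img_def by (intro twist_other_letters) auto
    then show ?thesis by simp
  next
    case True
    show ?thesis
    proof (cases "snd x")
      case s: True
      have "img i [x] = [x] @ gpow (other h) i" for i
        using True s by (cases x) (simp add: img_def letter_image_def twist_gens_def)
      then show ?thesis
        by (simp only: append g append_assoc) (intro reduce_cong_right, simp add: reduce_gpow_append reduce_id reduced_gpow)
    next
      case s: False
      have x: "img i [x] = gpow (other h) (- i) @ [x]" for i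
        using True s by (cases x) (simp add: img_def letter_image_def twist_gens_def inv_letter_def)
      show ?thesis
        unfolding x append g reduce_gpow_append_append by (simp add: add.commute)
    qed
  qed
  have "reduce (img m (img n w)) = reduce (img (m + n) w)"
  proof (induction w)
    case (Cons x w)
    have c: "img i (x # w) = img i [x] @ img i w" for i by (simp add: img_def)
    have "reduce (img m (img n (x # w))) = reduce (img m (img n [x]) @ img m (img n w))"
      unfolding c append ..
    also have "\<dots> = reduce (img m (img n [x]) @ img (m + n) w)"
      using Cons.IH by (rule reduce_cong_right)
    also have "\<dots> = reduce (img (m + n) [x] @ img (m + n) w)"
      using letter by (rule reduce_cong_left)
    finally show ?case unfolding c .
  qed (simp add: img_def)
  then show ?thesis using assms
    by (simp add: twist_def endo_of_apply img_def reduce_image_reduce)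
qed

lemma twist_auto: "twist h n \<in> auto F2"
  unfolding twist_def
proof (rule endo_of_auto[where g = "twist_gens h (- n)"])
  fix x assume "x \<in> {gen_a, gen_b}"
  then have "reduced x" by (auto simp: gen_a_def gen_b_def reduced_Cons)
  then show "endo_of (twist_gens h n) (endo_of (twist_gens h (- n)) x) = x"
    and "endo_of (twist_gens h (- n)) (endo_of (twist_gens h n) x) = x"
    by (simp_all flip: twist_def add: twist_add twist_0)
qed

text \<open>Automorphisms are extensional, so agreement on reduced words gives equality of
  functions, as identities in \<open>AutF2\<close> require.\<close>

lemma auto_F2_eqI:
  "f \<in> auto F2 \<Longrightarrow> g \<in> auto F2 \<Longrightarrow> (\<And>w. reduced w \<Longrightarrow> f w = g w) \<Longrightarrow> f = g"
  by (rule extensionalityI[where A = "carrier F2"]) (auto simp: auto_def Bij_def)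

lemma twist_mult: "twist h m \<otimes>\<^bsub>AutF2\<^esub> twist h n = twist h (m + n)"
proof (rule auto_F2_eqI)
  show "twist h m \<otimes>\<^bsub>AutF2\<^esub> twist h n \<in> auto F2"
    using monoid.m_closed[OF group.is_monoid[OF group_AutF2]] twist_auto by simp
  show "(twist h m \<otimes>\<^bsub>AutF2\<^esub> twist h n) w = twist h (m + n) w" if "reduced w" for w
    using that by (simp add: AutF2_mult_apply twist_auto twist_add)
qed (rule twist_auto)

lemma AutF2_one_apply: "reduced w \<Longrightarrow> \<one>\<^bsub>AutF2\<^esub> w = w"
  by (simp add: AutoGroup_def BijGroup_def)

lemma twist_0_eq_one: "twist h 0 = \<one>\<^bsub>AutF2\<^esub>"
proof (rule auto_F2_eqI)
  show "\<one>\<^bsub>AutF2\<^esub> \<in> auto F2"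
    using monoid.one_closed[OF group.is_monoid[OF group_AutF2]] by simp
qed (simp_all add: twist_auto twist_0 AutF2_one_apply)

lemma twist_int_pow: "twist h 1 [^]\<^bsub>AutF2\<^esub> (n::int) = twist h n"
proof -
  interpret group AutF2 by (rule group_AutF2)
  have nat: "twist h 1 [^]\<^bsub>AutF2\<^esub> (j::nat) = twist h (int j)" for j
  proof (induction j)
    case 0
    show ?case using twist_0_eq_one by simp
  next
    case (Suc j)
    show ?case using Suc.IH by (simp add: twist_mult add.commute)
  qed
  have inv: "inv\<^bsub>AutF2\<^esub> twist h i = twist h (- i)" for i
    by (rule inv_equality) (simp_all add: twist_mult twist_0_eq_one twist_auto)
  show ?thesis
  proof (cases n rule: int_cases2)
    case (nonneg j)
    then show ?thesis using nat by (simp add: int_pow_int)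
  next
    case (nonpos j)
    then show ?thesis using nat inv by (simp add: int_pow_neg int_pow_int twist_auto)
  qed
qed

lemma sigma_eq_twist: "\<sigma> = twist Gen_a 1"
proof -
  have "(case g of Gen_a \<Rightarrow> gen_a \<otimes>\<^bsub>F2\<^esub> gen_b | Gen_b \<Rightarrow> gen_b) = twist_gens Gen_a 1 g" for g
    by (cases g) (simp_all add: twist_gens_def F2_eval_simps)
  then show ?thesis unfolding sigma_def twist_def by presburger
qed

lemma tau_eq_twist: "\<tau> = twist Gen_b 1"
proof -
  have "(case g of Gen_a \<Rightarrow> gen_a | Gen_b \<Rightarrow> gen_b \<otimes>\<^bsub>F2\<^esub> gen_a) = twist_gens Gen_b 1 g" for g
    by (cases g) (simp_all add: twist_gens_def F2_eval_simps)
  then show ?thesis unfolding tau_def twist_def by presburger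
qed

section \<open>Chains\<close>

text \<open>The invariant carried along a chain. The bound on turns is what controls the powers of
  \<open>h\<close> created by the next twist of \<open>h\<close>; the bound on opposed gaps is what
  the growth argument needs.\<close>

definition controlled :: "bool \<Rightarrow> nat \<Rightarrow> word \<Rightarrow> bool" where
  "controlled s K w \<longleftrightarrow> (\<exists>c. cyclically_reduced c \<and> conjugate w c \<and> turns s c \<le> K \<and>
     (\<forall>h. opposition_le (int K + 1) s h c))"

lemma controlled_initial:
  assumes "reduced w" "\<parallel>w\<parallel> \<le> K" shows "controlled s K w"
proof -
  obtain c where c: "cyclically_reduced c" "conjugate w c"
    using cyclically_reduced_exists[OF assms(1)] by blast
  then have "length c \<le> K" using cyclic_length_eq assms by metis
  then have "turns s c \<le> K" "int (runs (other h) c) + 1 \<le> int K + 1" for h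
    using turns_le_length[of s c] runs_le_length[of "other h" c] by linarith+
  then show ?thesis
    unfolding controlled_def using c opposition_le_if_runs by blast
qed

lemma twist_other_word:
  assumes "reduced c" "\<forall>x\<in>set c. fst x \<noteq> h" shows "twist h n c = c"
  using assms twist_other_letters[OF assms(2)] by (simp add: twist_def endo_of_apply reduce_id)

lemma conjugate_twist_syllable_form:
  assumes "reduced w" "conjugate w (xs @ ys)" "cyclically_reduced (xs @ ys)"
    and "S \<noteq> []" "ys @ xs = syllable_word h S"
  shows "conjugate (twist h n w) (syllable_word h (shift n S))"
    and "cyclically_reduced (syllable_word h (shift n S))"
proof -
  have red: "cyclically_reduced (syllable_word h S)"
    using assms(3,5) cyclically_reduced_swap by metis
  then have "conjugate (xs @ ys) (syllable_word h S)"
    using conjugate_swap[of ys xs] assms(5) by (simp add: cyclically_reduced_def)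
  then have "conjugate (twist h n w) (twist h n (syllable_word h S))"
    unfolding twist_def using assms(1,2) conjugate_trans conjugate_endo_of by blast
  then show "conjugate (twist h n w) (syllable_word h (shift n S))"
    using conjugate_twist_syllable_word[OF assms(4) red] conjugate_trans by blast
  show "cyclically_reduced (syllable_word h (shift n S))"
    by (rule cyclically_reduced_shift[OF assms(4) red])
qed

lemma controlled_twist:
  assumes w: "reduced w" "controlled s K w" and l: "0 \<le> l"
  shows "controlled s K (twist h (dir s * l) w)"
proof -
  obtain c where c: "cyclically_reduced c" "conjugate w c" "turns s c \<le> K"
    and opp: "\<And>h. opposition_le (int K + 1) s h c"
    using w(2) unfolding controlled_def by blast
  \<comment> \<open>The case \<open>l = 0\<close> is separate because turns bound the new runs only
    for a proper twist.\<close>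
  consider "l = 0" | "\<forall>x\<in>set c. fst x \<noteq> h"
    | xs ys S where "0 < l" "c = xs @ ys" "S \<noteq> []" "ys @ xs = syllable_word h S"
        "\<forall>(e, m, e')\<in>set (cyclic_gaps S). - (int K + 1) \<le> dir s * (m * jump e e')"
    using opp[of h] l unfolding opposition_le_def by fastforce
  then show ?thesis
  proof cases
    case 1
    then show ?thesis using w by (simp add: twist_0)
  next
    case 2
    have "twist h (dir s * l) c = c"
      using 2 c(1) by (intro twist_other_word) (auto simp: cyclically_reduced_def)
    then have "conjugate (twist h (dir s * l) w) c"
      using conjugate_endo_of[OF c(2) w(1)] unfolding twist_def by metis
    then show ?thesis unfolding controlled_def using c opp by blast
  next
    case (3 xs ys S)
    let ?c = "syllable_word h (shift (dir s * l) S)"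
    have c': "conjugate (twist h (dir s * l) w) ?c" "cyclically_reduced ?c"
      using conjugate_twist_syllable_form[OF w(1), of xs ys S h] c 3 by auto
    have S: "cyclically_reduced (syllable_word h S)"
      using c(1) 3 cyclically_reduced_swap by metis
    have turns: "turns s (syllable_word h S) \<le> K"
      using c(3) 3 length_filter_cyclic_pairs_swap[of _ xs ys] by (simp add: turns_def)
    have "opposition_le (int K + 1) s g ?c" for g
    proof (cases "g = h")
      case True
      have "- (int K + 1) \<le> dir s * ((m + dir s * l * jump e e') * jump e e')"
        if "(e, m, e') \<in> set (cyclic_gaps S)" for e m e'
      proof -
        \<comment> \<open>As \<open>dir s\<close> squares to 1, the twist adds a nonnegative amount:
          opposition decreases.\<close>
        have "dir s * ((m + dir s * l * jump e e') * jump e e')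
            = dir s * (m * jump e e') + l * (jump e e')\<^sup>2"
          by (auto simp: dir_def power2_eq_square algebra_simps)
        moreover have "0 \<le> l * (jump e e')\<^sup>2" using 3(1) by simp
        moreover have "- (int K + 1) \<le> dir s * (m * jump e e')" using 3(5) that by fastforce
        ultimately show ?thesis by linarith
      qed
      then have "\<forall>(e, m, e')\<in>set (cyclic_gaps (shift (dir s * l) S)).
          - (int K + 1) \<le> dir s * (m * jump e e')"
        unfolding cyclic_gaps_shift by auto
      moreover have "?c = [] @ ?c" "?c @ [] = ?c" by simp_all
      moreover have "shift (dir s * l) S \<noteq> []" using 3(3) by simp
      ultimately show ?thesis unfolding opposition_le_def True by blast
    next
      case False
      then have g: "other g = h" by (cases g; cases h) auto
      \<comment> \<open>The gaps for the other generator \<open>g\<close> are powers of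
        \<open>h\<close>, so runs of \<open>h\<close> control them.\<close>
      have "runs h ?c \<le> K"
        using runs_shift_le[OF 3(1,3) S, of s] turns by linarith
      then show ?thesis using c'(2) by (intro opposition_le_if_runs) (simp_all add: g)
    qed
    moreover have "turns s ?c \<le> K"
      using turns_shift_le[OF l 3(3), of s h] turns by linarith
    ultimately show ?thesis unfolding controlled_def using c' by blast
  qed
qed

lemma chain_prod_auto: "chain_prod e lms \<in> auto F2"
proof -
  interpret group AutF2 by (rule group_AutF2)
  have "\<sigma> \<in> carrier AutF2" "\<tau> \<in> carrier AutF2" by (simp_all add: sigma_auto tau_auto)
  then have "chain_prod e lms \<in> carrier AutF2"
    by (induction e lms rule: chain_prod.induct)
       (simp_all only: chain_prod.simps one_closed m_closed int_pow_closed)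
  then show ?thesis by simp
qed

lemma auto_F2_reduced: "f \<in> auto F2 \<Longrightarrow> reduced w \<Longrightarrow> reduced (f w)"
  by (auto simp: auto_def hom_def)

text \<open>Every factor is a twist in direction \<open>dir s\<close> and preserves the invariant
  with the same \<open>K\<close>, so the bound does not deteriorate along the chain.\<close>

lemma controlled_chain_prod:
  "reduced w \<Longrightarrow> controlled s K w \<Longrightarrow> controlled s K (chain_prod (dir s) lms w)"
proof (induction lms arbitrary: w)
  case Nil
  then show ?case by (simp add: AutF2_one_apply)
next
  case (Cons lm lms)
  obtain l m where lm: "lm = (l, m)" by (cases lm)
  let ?S = "twist Gen_a (dir s * int l)" and ?T = "twist Gen_b (dir s * int m)"
  have "?T \<otimes>\<^bsub>AutF2\<^esub> ?S \<in> auto F2"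
    using monoid.m_closed[OF group.is_monoid[OF group_AutF2]] twist_auto by simp
  then have "chain_prod (dir s) (lm # lms) w = chain_prod (dir s) lms (?T (?S w))"
    using Cons.prems(1)
    by (simp add: lm sigma_eq_twist tau_eq_twist twist_int_pow AutF2_mult_apply
        chain_prod_auto twist_auto)
  then show ?case
    using Cons by (simp add: controlled_twist reduced_twist)
qed

section \<open>Growth of the cyclic length under powers of a twist\<close>

lemma length_shift:
  "int (length (syllable_word h (shift n S)))
    = int (length (cyclic_gaps S)) + (\<Sum>(e, m, e')\<leftarrow>cyclic_gaps S. \<bar>m + n * jump e e'\<bar>)"
  by (simp add: length_syllable_word shift_def comp_def case_prod_unfold)

text \<open>After \<open>k\<close> steps opposition is used up: the exponent is zero or has the sign
  in which it moves, so its absolute value grows by \<open>\<bar>jump e e'\<bar>\<close> per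
  step.\<close>

lemma abs_shift_linear:
  assumes "- k \<le> dir s * (m * jump e e')" "0 \<le> j"
  shows "\<bar>m + dir s * (k + j) * jump e e'\<bar> = \<bar>m + dir s * k * jump e e'\<bar> + j * \<bar>jump e e'\<bar>"
  using assms unfolding dir_def jump_def by (cases s; cases e; cases e') auto

lemma cyclic_length_twist_linear:
  assumes w: "reduced w" "controlled s K w"
  shows "\<exists>D::nat. \<forall>j::nat. \<parallel>twist h (dir s * (int K + 1 + int j)) w\<parallel>
     = \<parallel>twist h (dir s * (int K + 1)) w\<parallel> + j * D"
proof -
  obtain c where c: "cyclically_reduced c" "conjugate w c"
    and opp: "opposition_le (int K + 1) s h c"
    using w(2) unfolding controlled_def by blast
  from opp consider "\<forall>x\<in>set c. fst x \<noteq> h"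
    | xs ys S where "c = xs @ ys" "S \<noteq> []" "ys @ xs = syllable_word h S"
        "\<forall>(e, m, e')\<in>set (cyclic_gaps S). - (int K + 1) \<le> dir s * (m * jump e e')"
    unfolding opposition_le_def by blast
  then show ?thesis
  proof cases
    case 1
    have "\<parallel>twist h n w\<parallel> = length c" for n
    proof -
      have "twist h n c = c"
        using 1 c(1) by (intro twist_other_word) (auto simp: cyclically_reduced_def)
      then have "conjugate (twist h n w) c"
        using conjugate_endo_of[OF c(2) w(1)] unfolding twist_def by metis
      then show ?thesis using c(1) w(1) by (intro cyclic_length_eq reduced_twist)
    qed
    then show ?thesis by (intro exI[of _ 0]) simp
  next
    case (2 xs ys S)
    let ?G = "cyclic_gaps S" and ?k = "int K + 1"
    \<comment> \<open>The slope is the number of gaps between letters \<open>h\<close> of equal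
      sign.\<close>
    define D where "D = (\<Sum>(e, m, e')\<leftarrow>?G. nat \<bar>jump e e'\<bar>)"
    have D: "int D = (\<Sum>(e, m, e')\<leftarrow>?G. \<bar>jump e e'\<bar>)"
      unfolding D_def sum_list_of_nat[symmetric] by (simp add: comp_def case_prod_unfold)
    have len: "int \<parallel>twist h n w\<parallel> = int (length ?G) + (\<Sum>(e, m, e')\<leftarrow>?G. \<bar>m + n * jump e e'\<bar>)" for n
    proof -
      have "\<parallel>twist h n w\<parallel> = length (syllable_word h (shift n S))"
        using conjugate_twist_syllable_form[OF w(1), of xs ys S h n] c 2 w(1)
        by (intro cyclic_length_eq reduced_twist) auto
      then show ?thesis by (simp only: length_shift)
    qed
    have "\<parallel>twist h (dir s * (?k + int j)) w\<parallel> = \<parallel>twist h (dir s * ?k) w\<parallel> + j * D" for j :: nat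
    proof -
      have "(\<Sum>(e, m, e')\<leftarrow>?G. \<bar>m + dir s * (?k + int j) * jump e e'\<bar>)
          = (\<Sum>(e, m, e')\<leftarrow>?G. \<bar>m + dir s * ?k * jump e e'\<bar> + int j * \<bar>jump e e'\<bar>)"
        using 2(4) abs_shift_linear[of ?k s _ _ _ "int j"]
        by (intro arg_cong[where f = sum_list] map_cong) auto
      also have "\<dots> = (\<Sum>(e, m, e')\<leftarrow>?G. \<bar>m + dir s * ?k * jump e e'\<bar>) + int j * int D"
        unfolding D by (simp add: case_prod_unfold sum_list_addf sum_list_const_mult)
      finally have "int \<parallel>twist h (dir s * (?k + int j)) w\<parallel> = int (\<parallel>twist h (dir s * ?k) w\<parallel> + j * D)"
        by (simp add: len)
      then show ?thesis by (simp only: of_nat_eq_iff)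
    qed
    then show ?thesis by blast
  qed
qed

section \<open>Transfer of stationarity between boundedly translation equivalent elements\<close>

lemma no_growth_if_bounded_ratio:
  fixes C :: real and x y D E :: nat
  assumes "\<And>j::nat. real (x + j * D) \<le> C * real (y + j * E)" "E = 0"
  shows "D = 0"
proof (rule ccontr)
  assume "D \<noteq> 0"
  \<comment> \<open>With \<open>E = 0\<close> the upper bound is the constant
    \<open>C * real y\<close>, which a growing left side must exceed.\<close>
  obtain j :: nat where j: "C * real y < real j" using reals_Archimedean2 by blast
  have "real j \<le> real (x + j * D)" using \<open>D \<noteq> 0\<close> by (cases D) auto
  then show False using assms(1)[of j] assms(2) j by simp
qed

lemma boundedly_translation_equivalent_sym_bound:
  assumes "boundedly_translation_equivalent u v"
  obtains C :: real where "\<And>\<phi>. \<phi> \<in> auto F2 \<Longrightarrow> real \<parallel>\<phi> u\<parallel> \<le> C * real \<parallel>\<phi> v\<parallel>"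
    and "\<And>\<phi>. \<phi> \<in> auto F2 \<Longrightarrow> real \<parallel>\<phi> v\<parallel> \<le> C * real \<parallel>\<phi> u\<parallel>"
proof -
  obtain C :: real where "0 < C" and C: "\<And>\<phi>. \<phi> \<in> auto F2 \<Longrightarrow>
      1 / C \<le> real \<parallel>\<phi> u\<parallel> / real \<parallel>\<phi> v\<parallel> \<and> real \<parallel>\<phi> u\<parallel> / real \<parallel>\<phi> v\<parallel> \<le> C"
    using assms unfolding boundedly_translation_equivalent_def by blast
  have "real \<parallel>\<phi> u\<parallel> \<le> C * real \<parallel>\<phi> v\<parallel> \<and> real \<parallel>\<phi> v\<parallel> \<le> C * real \<parallel>\<phi> u\<parallel>" if "\<phi> \<in> auto F2" for \<phi>
  proof -
    \<comment> \<open>Division by zero yields 0, so a positive lower bound on the quotient forces a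
      nonzero denominator, which permits clearing it.\<close>
    have "0 < 1 / C" using \<open>0 < C\<close> by simp
    then have "0 < real \<parallel>\<phi> u\<parallel> / real \<parallel>\<phi> v\<parallel>" using C[OF that] by linarith
    then have "0 < real \<parallel>\<phi> v\<parallel>" by (cases "\<parallel>\<phi> v\<parallel> = 0") auto
    then show ?thesis using C[OF that] \<open>0 < C\<close> by (simp add: field_simps)
  qed
  then show thesis using that by blast
qed

lemma cyclic_length_stationary_iff:
  assumes "reduced u" "reduced v" "\<parallel>u\<parallel> \<ge> \<parallel>v\<parallel>" "boundedly_translation_equivalent u v"
    and \<psi>: "\<psi> = chain_prod (dir s) lms" and k: "k = int \<parallel>u\<parallel> + 1"
  shows "\<parallel>(twist h (dir s * (k + 1)) \<otimes>\<^bsub>AutF2\<^esub> \<psi>) u\<parallel> = \<parallel>(twist h (dir s * k) \<otimes>\<^bsub>AutF2\<^esub> \<psi>) u\<parallel> \<longleftrightarrow>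
    \<parallel>(twist h (dir s * (k + 1)) \<otimes>\<^bsub>AutF2\<^esub> \<psi>) v\<parallel> = \<parallel>(twist h (dir s * k) \<otimes>\<^bsub>AutF2\<^esub> \<psi>) v\<parallel>"
proof -
  have auto: "\<psi> \<in> auto F2" unfolding \<psi> by (rule chain_prod_auto)
  define f where "f = (\<lambda>w (j::nat). \<parallel>(twist h (dir s * (k + int j)) \<otimes>\<^bsub>AutF2\<^esub> \<psi>) w\<parallel>)"
  \<comment> \<open>Both words use the threshold \<open>K = \<parallel>u\<parallel>\<close>; for
    \<open>v\<close> this is where
    \<open>\<parallel>v\<parallel> \<le> \<parallel>u\<parallel>\<close> enters.\<close>
  have linear: "\<exists>D. \<forall>j. f w j = f w 0 + j * D" if "reduced w" "\<parallel>w\<parallel> \<le> \<parallel>u\<parallel>" for w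
  proof -
    have "controlled s \<parallel>u\<parallel> (\<psi> w)" "reduced (\<psi> w)"
      using that auto controlled_chain_prod controlled_initial auto_F2_reduced unfolding \<psi> by blast+
    from cyclic_length_twist_linear[OF this(2,1), of h] show ?thesis
      using that auto by (simp add: f_def k AutF2_mult_apply twist_auto)
  qed
  obtain D where D: "\<And>j. f u j = f u 0 + j * D" using linear assms(1) by blast
  obtain E where E: "\<And>j. f v j = f v 0 + j * E" using linear assms(2,3) by blast
  obtain C :: real where "\<And>\<phi>. \<phi> \<in> auto F2 \<Longrightarrow> real \<parallel>\<phi> u\<parallel> \<le> C * real \<parallel>\<phi> v\<parallel>"
    and "\<And>\<phi>. \<phi> \<in> auto F2 \<Longrightarrow> real \<parallel>\<phi> v\<parallel> \<le> C * real \<parallel>\<phi> u\<parallel>"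
    using boundedly_translation_equivalent_sym_bound[OF assms(4)] by blast
  moreover have "twist h n \<otimes>\<^bsub>AutF2\<^esub> \<psi> \<in> auto F2" for n
    using monoid.m_closed[OF group.is_monoid[OF group_AutF2]] twist_auto auto by simp
  ultimately have "real (f u j) \<le> C * real (f v j)" "real (f v j) \<le> C * real (f u j)" for j
    unfolding f_def by blast+
  then have "D = 0 \<longleftrightarrow> E = 0"
    using no_growth_if_bounded_ratio[of "f u 0" D C "f v 0" E]
      no_growth_if_bounded_ratio[of "f v 0" E C "f u 0" D] D E by metis
  \<comment> \<open>For an affine function one stationary step already means slope 0, so
    stationarity at \<open>k\<close> is a statement about slopes.\<close>
  moreover have "f u 1 = f u 0 \<longleftrightarrow> D = 0" "f v 1 = f v 0 \<longleftrightarrow> E = 0"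
    using D[of 1] E[of 1] by simp_all
  ultimately show ?thesis by (simp add: f_def)
qed

theorem theorem3p8:
  fixes u v :: word and k :: int and \<Omega> \<Omega>\<^sub>1 \<Omega>\<^sub>2 :: "chain set"
  assumes "u \<in> carrier F2" "v \<in> carrier F2" "u \<noteq> \<one>\<^bsub>F2\<^esub>" "v \<noteq> \<one>\<^bsub>F2\<^esub>"
    and "\<parallel>u\<parallel> \<ge> \<parallel>v\<parallel>"
    and "\<Omega> = {c. chain_length c \<le> 2 * \<parallel>u\<parallel> + 5}"
    and "\<Omega>\<^sub>1 = \<Omega> \<inter> range C1"
    and "\<Omega>\<^sub>2 = \<Omega> \<inter> range C2"
    and "k = int \<parallel>u\<parallel> + 1"
    and "boundedly_translation_equivalent u v"
  shows "(\<forall>c\<in>\<Omega>\<^sub>1. let \<psi>\<^sub>1 = chain_aut c in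
      (\<parallel>(\<sigma> [^]\<^bsub>AutF2\<^esub> (k + 1) \<otimes>\<^bsub>AutF2\<^esub> \<psi>\<^sub>1) u\<parallel> = \<parallel>(\<sigma> [^]\<^bsub>AutF2\<^esub> k \<otimes>\<^bsub>AutF2\<^esub> \<psi>\<^sub>1) u\<parallel> \<longleftrightarrow>
       \<parallel>(\<sigma> [^]\<^bsub>AutF2\<^esub> (k + 1) \<otimes>\<^bsub>AutF2\<^esub> \<psi>\<^sub>1) v\<parallel> = \<parallel>(\<sigma> [^]\<^bsub>AutF2\<^esub> k \<otimes>\<^bsub>AutF2\<^esub> \<psi>\<^sub>1) v\<parallel>) \<and>
      (\<parallel>(\<tau> [^]\<^bsub>AutF2\<^esub> (k + 1) \<otimes>\<^bsub>AutF2\<^esub> \<psi>\<^sub>1) u\<parallel> = \<parallel>(\<tau> [^]\<^bsub>AutF2\<^esub> k \<otimes>\<^bsub>AutF2\<^esub> \<psi>\<^sub>1) u\<parallel> \<longleftrightarrow>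
       \<parallel>(\<tau> [^]\<^bsub>AutF2\<^esub> (k + 1) \<otimes>\<^bsub>AutF2\<^esub> \<psi>\<^sub>1) v\<parallel> = \<parallel>(\<tau> [^]\<^bsub>AutF2\<^esub> k \<otimes>\<^bsub>AutF2\<^esub> \<psi>\<^sub>1) v\<parallel>)) \<and>
    (\<forall>c\<in>\<Omega>\<^sub>2. let \<psi>\<^sub>2 = chain_aut c in
      (\<parallel>(\<sigma> [^]\<^bsub>AutF2\<^esub> (- k - 1) \<otimes>\<^bsub>AutF2\<^esub> \<psi>\<^sub>2) u\<parallel> = \<parallel>(\<sigma> [^]\<^bsub>AutF2\<^esub> (- k) \<otimes>\<^bsub>AutF2\<^esub> \<psi>\<^sub>2) u\<parallel> \<longleftrightarrow>
       \<parallel>(\<sigma> [^]\<^bsub>AutF2\<^esub> (- k - 1) \<otimes>\<^bsub>AutF2\<^esub> \<psi>\<^sub>2) v\<parallel> = \<parallel>(\<sigma> [^]\<^bsub>AutF2\<^esub> (- k) \<otimes>\<^bsub>AutF2\<^esub> \<psi>\<^sub>2) v\<parallel>) \<and>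
      (\<parallel>(\<tau> [^]\<^bsub>AutF2\<^esub> (- k - 1) \<otimes>\<^bsub>AutF2\<^esub> \<psi>\<^sub>2) u\<parallel> = \<parallel>(\<tau> [^]\<^bsub>AutF2\<^esub> (- k) \<otimes>\<^bsub>AutF2\<^esub> \<psi>\<^sub>2) u\<parallel> \<longleftrightarrow>
       \<parallel>(\<tau> [^]\<^bsub>AutF2\<^esub> (- k - 1) \<otimes>\<^bsub>AutF2\<^esub> \<psi>\<^sub>2) v\<parallel> = \<parallel>(\<tau> [^]\<^bsub>AutF2\<^esub> (- k) \<otimes>\<^bsub>AutF2\<^esub> \<psi>\<^sub>2) v\<parallel>))"
proof -
  have red: "reduced u" "reduced v" using assms(1,2) by simp_all
  note iff = cyclic_length_stationary_iff[OF red assms(5,10) _ assms(9)]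
  \<comment> \<open>This puts the exponents for type (C2) into the form
    \<open>dir False * (k + 1)\<close>, so that both types are instances of
    \<open>iff\<close>.\<close>
  have neg: "- k - 1 = - (k + 1)" by simp
  show ?thesis
    unfolding Let_def neg sigma_eq_twist tau_eq_twist twist_int_pow
    using iff[of _ True] iff[of _ False] by (auto simp: dir_def assms(7,8))
qed

end
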